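(* Let $M\ge 1$, let $S\in\mathbb{R}^{M\times M}$ be a constant skew-symmetric matrix, $S^{T}=-S$, and let $Q(t)\in\mathbb{R}^{M\times M}$ be a solution of the dynamical system $\dot Q=SQ$, $Q(t_0)^{T}Q(t_0)=I$. Then the generalized energy $$E(t)=\operatorname{trace}\left(Q(t)^{T}Q(t)\right)=\sum_{i=1}^{M}\sum_{j=1}^{M}q_{ij}(t)^{2}$$ is constant in $t$, where $q_{ij}(t)$ are the entries of $Q(t)$. *)

theory Defs
  imports "HOL-Analysis.Analysis"
begin

definition generalized_energy :: "(real \<Rightarrow> real ^ 'm ^ 'm) \<Rightarrow> real \<Rightarrow> real" where
  "generalized_energy Q t = trace (transpose (Q t) ** Q t)"

end

theory Submission
  imports Defs
begin

text \<open>
  The energy is the squared Euclidean (Frobenius) norm \<open>Q t \<bullet> Q t\<close>, so its derivative along a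
  solution is \<open>2 * (Q t \<bullet> (S ** Q t))\<close>. Left multiplication by \<open>transpose S\<close> is the adjoint of left
  multiplication by \<open>S\<close> for this inner product; for skew-symmetric \<open>S\<close> the velocity \<open>S ** Q t\<close> is
  therefore orthogonal to \<open>Q t\<close>. The derivative vanishes on the interval, and the energy is
  constant there.
\<close>

lemma inner_matrix_sum:
  fixes A B :: "real ^ 'n ^ 'm"
  shows "A \<bullet> B = (\<Sum>i\<in>UNIV. \<Sum>j\<in>UNIV. A $ i $ j * B $ i $ j)"
  by (simp add: inner_vec_def)

lemma trace_transpose_matrix_mult:
  fixes A B :: "real ^ 'n ^ 'm"
  shows "trace (transpose A ** B) = A \<bullet> B"
  unfolding inner_matrix_sum
  by (simp add: trace_def transpose_def matrix_matrix_mult_def) (rule sum.swap)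

lemma inner_matrix_mult_left:
  fixes S :: "real ^ 'k ^ 'm" and A :: "real ^ 'n ^ 'm" and B :: "real ^ 'n ^ 'k"
  shows "A \<bullet> (S ** B) = (transpose S ** A) \<bullet> B"
proof -
  have "trace (transpose A ** (S ** B)) = trace (transpose (transpose S ** A) ** B)"
    by (simp add: matrix_transpose_mul matrix_mul_assoc)
  then show ?thesis
    by (simp only: trace_transpose_matrix_mult)
qed

text \<open>
  By adjointness the inner product below equals its own negative.
\<close>

lemma skew_symmetric_orthogonal:
  fixes S :: "real ^ 'm ^ 'm" and A :: "real ^ 'n ^ 'm"
  assumes "transpose S = - S"
  shows "A \<bullet> (S ** A) = 0"
proof -
  have "- S ** A = - (S ** A)"
    by (simp add: matrix_matrix_mult_def vec_eq_iff sum_negf)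
  then have "A \<bullet> (S ** A) = - ((S ** A) \<bullet> A)"
    using inner_matrix_mult_left[of A S A] assms by simp
  then show ?thesis
    by (simp add: inner_commute)
qed

theorem mainTheorem2:
  fixes S :: "real ^ 'm ^ 'm"
    and Q :: "real \<Rightarrow> real ^ 'm ^ 'm"
    and T :: "real set"
    and t\<^sub>0 :: real
  assumes skew: "transpose S = - S"
    and interval: "is_interval T" "t\<^sub>0 \<in> T"
    and ode: "\<And>t. t \<in> T \<Longrightarrow> (Q has_vector_derivative (S ** Q t)) (at t within T)"
    and init: "transpose (Q t\<^sub>0) ** Q t\<^sub>0 = mat 1"
  shows "(\<forall>t\<in>T. generalized_energy Q t = (\<Sum>i\<in>UNIV. \<Sum>j\<in>UNIV. (Q t $ i $ j)\<^sup>2))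
    \<and> generalized_energy Q constant_on T"
proof
  have energy: "generalized_energy Q t = Q t \<bullet> Q t" for t
    by (simp add: generalized_energy_def trace_transpose_matrix_mult)
  then show "\<forall>t\<in>T. generalized_energy Q t = (\<Sum>i\<in>UNIV. \<Sum>j\<in>UNIV. (Q t $ i $ j)\<^sup>2)"
    by (simp add: inner_matrix_sum power2_eq_square)
  have "(generalized_energy Q has_derivative (\<lambda>h. 0)) (at t within T)" if "t \<in> T" for t
  proof -
    have Q': "(Q has_derivative (\<lambda>h. h *\<^sub>R (S ** Q t))) (at t within T)"
      using ode[OF that] by (simp add: has_vector_derivative_def)
    have "((\<lambda>t. Q t \<bullet> Q t) has_derivative
        (\<lambda>h. Q t \<bullet> (h *\<^sub>R (S ** Q t)) + (h *\<^sub>R (S ** Q t)) \<bullet> Q t)) (at t within T)"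
      by (rule has_derivative_inner[OF Q' Q'])
    moreover have "(S ** Q t) \<bullet> Q t = 0"
      using skew_symmetric_orthogonal[OF skew] by (simp add: inner_commute)
    moreover have "generalized_energy Q = (\<lambda>t. Q t \<bullet> Q t)"
      using energy by (rule ext)
    ultimately show ?thesis
      by (simp add: skew_symmetric_orthogonal[OF skew])
  qed
  moreover have "convex T"
    using interval(1) by (rule is_interval_convex)
  ultimately obtain c where "\<And>t. t \<in> T \<Longrightarrow> generalized_energy Q t = c"
    using has_derivative_zero_constant[of T "generalized_energy Q"] by metis
  then show "generalized_energy Q constant_on T"
    unfolding constant_on_def by blast
qed

end
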